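(* The algorithm VerifyArchitecture (given in full in the context) has polynomial-time complexity and checks whether an architecture $\langle\mathcal{B},\gamma\rangle$ conforms to a simple architecture diagram $\langle\mathcal{T},n,\mathcal{C}\rangle$. More precisely, it checks the validity of the following three statements, by means of its functions VerifyCardinality, VerifyMultiplicity and VerifyDegree, respectively: 1) the number of components of each type $T$ is equal to $n(T)$; 2) there exists a partition of $\gamma$ into $\gamma_1,\dots,\gamma_l$ such that each $\gamma_i$ corresponds to a different connector motif $\Gamma_i\in\mathcal{C}$ of the diagram (each connector in $\gamma_i$ conforms to the multiplicity constraints of $\Gamma_i$); 3) for each connector motif $\Gamma_i$ and its corresponding $\gamma_i$, the number of times each port instance participates in $\gamma_i$ satisfies the degree constraints. If all three statements are valid, the algorithm returns true, i.e. the architecture conforms to the diagram; otherwise it returns false.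
   Context: Definitions. A component type $T$ has a set of generic ports $T.P$. A simple architecture diagram $\langle \mathcal{T}, n, \mathcal{C}\rangle$ consists of: a set of component types $\mathcal{T}=\{T_1,\dots,T_k\}$; a cardinality function $n:\mathcal{T}\to\mathbb{N}$ (natural numbers), with $n_i=n(T_i)$; a set of connector motifs $\mathcal{C}=\{\Gamma_1,\dots,\Gamma_l\}$ of the form $\Gamma=(a,\{m_p:d_p\}_{p\in a})$, where $\emptyset\ne a\subseteq\bigcup_{i=1}^k T_i.P$ is a generic connector and $m_p,d_p\in\mathbb{N}$ (with $m_p>0$) are the multiplicity and degree associated to the generic port $p\in a$. It is assumed that for any two connector motifs $(a,\{m_p^i:d_p^i\}_{p\in a})$, $i=1,2$, with the same set of generic ports $a$, there exists $p\in a$ with $m_p^1\neq m_p^2$. An architecture is a pair $\langle\mathcal{B},\gamma\rangle$, where $\mathcal{B}$ is a set of components and $\gamma$ is a configuration, i.e. a set of connectors among the ports of components in $\mathcal{B}$; a connector is a set of ports that must interact. A component $B$ is of type $T$ if the ports of $B$ are in bijective correspondence with the generic ports of $T$. If $B_1,\dots,B_N$ are all the components of type $T$ in $\mathcal{B}$ and $p\in T.P$, the corresponding port instances are denoted $p_1,\dots,p_N$. An architecture $\langle\mathcal{B},\gamma\rangle$ conforms to $\langle\mathcal{T},n,\mathcal{C}\rangle$ if, for each $i\in[1,k]$, the number of components of type $T_i$ in $\mathcal{B}$ is equal to $n_i$, and $\gamma$ can be partitioned into disjoint sets $\gamma_1,\dots,\gamma_l$ such that, for each connector motif $\Gamma_j=(a,\{m_p:d_p\}_{p\in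 a})\in\mathcal{C}$ and each $p\in a$: 1) there are exactly $m_p$ instances of $p$ in each connector in $\gamma_j$; 2) each instance of $p$ is involved in exactly $d_p$ connectors in $\gamma_j$. The algorithm. Auxiliary operations: generic$(p_i)$ returns the generic port of which $p_i$ is an instance; typeof$(B)$ returns the component type of $B$; for a map, the operation map[key]++ increases the value associated with the key by one if the key is in the map, and otherwise adds the key with value 1; keys(map) is the set of keys of the map. VerifyArchitecture (input: architecture $\langle\mathcal{B},\gamma\rangle$, diagram $\langle\mathcal{T},n,\mathcal{C}\rangle$): if VerifyCardinality$(\mathcal{B},\langle\mathcal{T},n,\mathcal{C}\rangle)$ is false, return false. Let $S_\gamma:=$ VerifyMultiplicity$(\gamma,\mathcal{C})$; if $S_\gamma=\emptyset$, return false. For each $\Gamma\in\mathcal{C}$: if VerifyDegree$(S_\gamma[\Gamma],\Gamma)$ is false, return false. Return true. VerifyCardinality$(\mathcal{B},\langle\mathcal{T},n,\mathcal{C}\rangle)$: start with an empty map countTypes; for each $B_i\in\mathcal{B}$ do countTypes[typeof$(B_i)$]++. For each $T_i\in\mathcal{T}$: if countTypes$[T_i]\ne n(T_i)$, return false. Return true. VerifyMultiplicity$(\gamma,\mathcal{C})$: create a map partition with partition$[\Gamma]=\emptyset$ for each $\Gamma\in\mathcal{C}$. For each connector $k\in\gamma$: start with an empty map portscount and, for each $p_i\in k$, do portscount[generic$(p_i)$]++; then go through the motifs $\Gamma=(a,\{m_p:d_p\}_{p\in a})\in\mathcal{C}$, and at the first one such that $a=$ keys(portscount) and portscount$[p]=m_p$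 for all $p\in a$, add $k$ to partition$[\Gamma]$ and stop going through the motifs; if no such motif is found, return $\emptyset$. After all connectors are processed, return partition. VerifyDegree$(\gamma_i,\Gamma)$: start with an empty map degrees; for each $k\in\gamma_i$ and each $p_i\in k$ do degrees$[p_i]$++. For each $p_i\in$ keys(degrees): if degrees$[p_i]\neq d_{\mathrm{generic}(p_i)}$ (the degree of generic$(p_i)$ in $\Gamma$), return false. Return true.
   Formalization: "True iff it conforms" is proved when each instance of p with d_p>0 lies in a connector matching the motif; statement 3 covers only participating instances; connectors in γ_j have only instances of ports in a; the failure value ∅ is kept distinct from an empty partition map. *)

theory Defs
  imports
    "HOL-Library.Monad_Syntax"
    "HOL-Library.Disjoint_Sets"
    "HOL-Computational_Algebra.Polynomial"
begin

section \<open>Architecture diagrams and architectures\<close>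

text \<open>
  Type variables: \<open>'t\<close> component types, \<open>'p\<close> generic ports, \<open>'b\<close> components,
  \<open>'q\<close> ports of components (port instances).

  A connector motif \<open>(a, {m\<^sub>p : d\<^sub>p})\<close> is the finite family \<open>p \<mapsto> (m\<^sub>p, d\<^sub>p)\<close>, that is,
  a partial map whose domain is the generic connector \<open>a\<close>.
\<close>

type_synonym 'p motif = "'p \<rightharpoonup> nat \<times> nat"

definition gconn :: "'p motif \<Rightarrow> 'p set" where
  "gconn \<Gamma> = dom \<Gamma>"

definition mult :: "'p motif \<Rightarrow> 'p \<Rightarrow> nat" where
  "mult \<Gamma> p = fst (the (\<Gamma> p))"

definition deg :: "'p motif \<Rightarrow> 'p \<Rightarrow> nat" where
  "deg \<Gamma> p = snd (the (\<Gamma> p))"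

record ('t, 'p) diagram =
  types :: "'t set"
  gports :: "'t \<Rightarrow> 'p set"
  cardinality :: "'t \<Rightarrow> nat"
  motifs :: "'p motif set"

definition simple_diagram :: "('t, 'p) diagram \<Rightarrow> bool" where
  "simple_diagram D \<longleftrightarrow>
     finite (types D) \<and> finite (motifs D) \<and>
     (\<forall>\<Gamma>\<in>motifs D. finite (gconn \<Gamma>) \<and> gconn \<Gamma> \<noteq> {} \<and>
        gconn \<Gamma> \<subseteq> (\<Union>T\<in>types D. gports D T) \<and> (\<forall>p\<in>gconn \<Gamma>. mult \<Gamma> p > 0)) \<and>
     (\<forall>\<Gamma>\<in>motifs D. \<forall>\<Gamma>'\<in>motifs D. \<Gamma> \<noteq> \<Gamma>' \<and> gconn \<Gamma> = gconn \<Gamma>' \<longrightarrow>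
        (\<exists>p\<in>gconn \<Gamma>. mult \<Gamma> p \<noteq> mult \<Gamma>' p))"

record ('b, 'q, 't, 'p) architecture =
  components :: "'b set"
  config :: "'q set set"
  ports :: "'b \<Rightarrow> 'q set"
  typeof :: "'b \<Rightarrow> 't"
  generic :: "'q \<Rightarrow> 'p"

text \<open>
  Well-formedness of an architecture whose components are typed by the component types of \<open>D\<close>:
  \<open>generic\<close> is the bijection that makes a component \<open>B\<close> a component of type \<open>typeof B\<close>.
\<close>

definition architecture_over :: "('t, 'p) diagram \<Rightarrow> ('b, 'q, 't, 'p) architecture \<Rightarrow> bool" where
  "architecture_over D A \<longleftrightarrow>
     finite (components A) \<and> finite (config A) \<and>
     (\<forall>B\<in>components A. bij_betw (generic A) (ports A B) (gports D (typeof A B))) \<and>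
     disjoint_family_on (ports A) (components A) \<and>
     (\<forall>k\<in>config A. finite k \<and> k \<subseteq> (\<Union>B\<in>components A. ports A B))"

definition port_instances :: "('b, 'q, 't, 'p) architecture \<Rightarrow> 'p \<Rightarrow> 'q set" where
  "port_instances A p = {q. \<exists>B\<in>components A. q \<in> ports A B \<and> generic A q = p}"


section \<open>Conformance\<close>

definition cardinalities_hold ::
    "('b, 'q, 't, 'p) architecture \<Rightarrow> ('t, 'p) diagram \<Rightarrow> bool" where
  "cardinalities_hold A D \<longleftrightarrow>
     (\<forall>T\<in>types D. card {B \<in> components A. typeof A B = T} = cardinality D T)"

text \<open>
  A connector of the motif \<open>\<Gamma>\<close> is an instance of the generic connector \<open>gconn \<Gamma>\<close>, so it
  contains instances of the generic ports in \<open>gconn \<Gamma>\<close> only.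
\<close>

definition multiplicities_hold ::
    "('b, 'q, 't, 'p) architecture \<Rightarrow> 'p motif \<Rightarrow> 'q set \<Rightarrow> bool" where
  "multiplicities_hold A \<Gamma> k \<longleftrightarrow>
     generic A ` k \<subseteq> gconn \<Gamma> \<and>
     (\<forall>p\<in>gconn \<Gamma>. card (k \<inter> port_instances A p) = mult \<Gamma> p)"

text \<open>
  The parts are indexed by the motifs. A part may be empty, e.g. when all degrees of its motif are
  zero or when there are no components of the types concerned.
\<close>

definition motif_partition ::
    "('b, 'q, 't, 'p) architecture \<Rightarrow> ('t, 'p) diagram \<Rightarrow> ('p motif \<Rightarrow> 'q set set) \<Rightarrow> bool" where
  "motif_partition A D part \<longleftrightarrow>
     (\<Union>\<Gamma>\<in>motifs D. part \<Gamma>) = config A \<and>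
     disjoint_family_on part (motifs D) \<and>
     (\<forall>\<Gamma>\<in>motifs D. \<forall>k\<in>part \<Gamma>. multiplicities_hold A \<Gamma> k)"

definition degrees_hold ::
    "('b, 'q, 't, 'p) architecture \<Rightarrow> 'p motif \<Rightarrow> 'q set set \<Rightarrow> bool" where
  "degrees_hold A \<Gamma> K \<longleftrightarrow>
     (\<forall>p\<in>gconn \<Gamma>. \<forall>q\<in>port_instances A p. card {k \<in> K. q \<in> k} = deg \<Gamma> p)"

definition conforms ::
    "('b, 'q, 't, 'p) architecture \<Rightarrow> ('t, 'p) diagram \<Rightarrow> bool" where
  "conforms A D \<longleftrightarrow>
     cardinalities_hold A D \<and>
     (\<exists>part. motif_partition A D part \<and> (\<forall>\<Gamma>\<in>motifs D. degrees_hold A \<Gamma> (part \<Gamma>)))"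

text \<open>
  The degree constraints as far as they concern the port instances that participate in \<open>K\<close>.
  VerifyDegree has only \<open>K\<close> and \<open>\<Gamma>\<close> as arguments and never sees the other instances.
\<close>

definition participant_degrees_hold ::
    "('b, 'q, 't, 'p) architecture \<Rightarrow> 'p motif \<Rightarrow> 'q set set \<Rightarrow> bool" where
  "participant_degrees_hold A \<Gamma> K \<longleftrightarrow>
     (\<forall>p\<in>gconn \<Gamma>. \<forall>q\<in>port_instances A p \<inter> \<Union>K. card {k \<in> K. q \<in> k} = deg \<Gamma> p)"

text \<open>
  No instance that a motif requires to be connected (\<open>d\<^sub>p > 0\<close>) is left out of all the connectors
  of that motif. The algorithm does not check this: for a single type with \<open>n = 2\<close> and a single
  port \<open>p\<close>, the single motif \<open>({p}, {1 : 1})\<close> and the configuration \<open>{{p\<^sub>1}}\<close>, it returns true,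
  although \<open>p\<^sub>2\<close> is involved in no connector and the architecture does not conform.
\<close>

definition no_idle_instance ::
    "('b, 'q, 't, 'p) architecture \<Rightarrow> ('t, 'p) diagram \<Rightarrow> bool" where
  "no_idle_instance A D \<longleftrightarrow>
     (\<forall>\<Gamma>\<in>motifs D. \<forall>p\<in>gconn \<Gamma>. deg \<Gamma> p > 0 \<longrightarrow>
        (\<forall>q\<in>port_instances A p. \<exists>k\<in>config A. q \<in> k \<and> multiplicities_hold A \<Gamma> k))"


section \<open>Computations with running time\<close>

text \<open>
  Unit-cost model: every call of a loop body or recursive function, every comparison of two atomic
  values (identifiers of ports and types, numbers) and every call of \<open>typeof\<close> or \<open>generic\<close> is one
  step. Sets and maps are lists, so that membership tests, map accesses and comparisons of
  motifs are charged for the traversal.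
\<close>

datatype 'a timed = Timed (val: 'a) (time: nat)

definition ret :: "'a \<Rightarrow> 'a timed" where
  "ret x = Timed x 0"

definition bind_timed :: "'a timed \<Rightarrow> ('a \<Rightarrow> 'b timed) \<Rightarrow> 'b timed" where
  "bind_timed m f = Timed (val (f (val m))) (time m + time (f (val m)))"

adhoc_overloading Monad_Syntax.bind \<rightleftharpoons> bind_timed

definition step :: "'a timed \<Rightarrow> 'a timed" where
  "step m = Timed (val m) (Suc (time m))"

definition op :: "'a \<Rightarrow> 'a timed" where
  "op x = step (ret x)"

primrec for_each :: "('a \<Rightarrow> 's \<Rightarrow> 's timed) \<Rightarrow> 'a list \<Rightarrow> 's \<Rightarrow> 's timed" where
  "for_each f [] s = step (ret s)"
| "for_each f (x # xs) s = step (do { s' \<leftarrow> f x s; for_each f xs s' })"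

primrec check_all :: "('a \<Rightarrow> bool timed) \<Rightarrow> 'a list \<Rightarrow> bool timed" where
  "check_all P [] = step (ret True)"
| "check_all P (x # xs) = step (do { b \<leftarrow> P x; if b then check_all P xs else ret False })"

definition eq_atom :: "'a \<Rightarrow> 'a \<Rightarrow> bool timed" where
  "eq_atom x y = op (x = y)"

fun eq_list :: "'a list \<Rightarrow> 'a list \<Rightarrow> bool timed" where
  "eq_list (x # xs) (y # ys) =
     step (do { b \<leftarrow> eq_atom x y; if b then eq_list xs ys else ret False })"
| "eq_list [] [] = step (ret True)"
| "eq_list _ _ = step (ret False)"

text \<open>Maps are association lists; \<open>eq\<close> is the comparison of keys.\<close>

primrec lookup :: "('k \<Rightarrow> 'k \<Rightarrow> bool timed) \<Rightarrow> 'k \<Rightarrow> ('k \<times> 'v) list \<Rightarrow> 'v option timed" where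
  "lookup eq k [] = step (ret None)"
| "lookup eq k (e # m) =
     step (do { b \<leftarrow> eq k (fst e); if b then ret (Some (snd e)) else lookup eq k m })"

definition has_key :: "'k \<Rightarrow> ('k \<times> 'v) list \<Rightarrow> bool timed" where
  "has_key k m = do { r \<leftarrow> lookup eq_atom k m; op (r \<noteq> None) }"

text \<open>A missing key counts as zero, which matters for types with \<open>n(T) = 0\<close>.\<close>

definition count :: "'k \<Rightarrow> ('k \<times> nat) list \<Rightarrow> nat timed" where
  "count k m = do { r \<leftarrow> lookup eq_atom k m; op (case r of None \<Rightarrow> 0 | Some c \<Rightarrow> c) }"

primrec incr :: "'k \<Rightarrow> ('k \<times> nat) list \<Rightarrow> ('k \<times> nat) list timed" where
  "incr k [] = step (ret [(k, 1)])"
| "incr k (e # m) =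
     step (do {
       b \<leftarrow> eq_atom k (fst e);
       if b then ret ((k, Suc (snd e)) # m)
       else do { m' \<leftarrow> incr k m; ret (e # m') } })"


section \<open>The algorithm\<close>

text \<open>
  The input presents all finite sets as lists, the cardinality function as a list of pairs
  \<open>(T, n(T))\<close>, and a motif as a list of triples \<open>(p, m\<^sub>p, d\<^sub>p)\<close>.
\<close>

type_synonym 'p motif_list = "('p \<times> nat \<times> nat) list"

record ('b, 'q, 't, 'p) input =
  in_components :: "'b list"
  in_config :: "'q list list"
  in_types :: "('t \<times> nat) list"
  in_motifs :: "'p motif_list list"

definition represents ::
    "('b, 'q, 't, 'p) input \<Rightarrow> ('b, 'q, 't, 'p) architecture \<Rightarrow> ('t, 'p) diagram \<Rightarrow> bool" where
  "represents I A D \<longleftrightarrow>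
     distinct (in_components I) \<and> set (in_components I) = components A \<and>
     (\<forall>k\<in>set (in_config I). distinct k) \<and> distinct (map set (in_config I)) \<and>
     set ` set (in_config I) = config A \<and>
     distinct (map fst (in_types I)) \<and> fst ` set (in_types I) = types D \<and>
     (\<forall>(T, c)\<in>set (in_types I). c = cardinality D T) \<and>
     (\<forall>\<Gamma>\<in>set (in_motifs I). distinct (map fst \<Gamma>)) \<and> distinct (map map_of (in_motifs I)) \<and>
     map_of ` set (in_motifs I) = motifs D"

definition input_size :: "('b, 'q, 't, 'p) input \<Rightarrow> nat" where
  "input_size I =
     length (in_components I) + sum_list (map (\<lambda>k. Suc (length k)) (in_config I)) +
     length (in_types I) + sum_list (map (\<lambda>\<Gamma>. Suc (length \<Gamma>)) (in_motifs I))"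

definition verify_cardinality ::
    "('b \<Rightarrow> 't) \<Rightarrow> 'b list \<Rightarrow> ('t \<times> nat) list \<Rightarrow> bool timed" where
  "verify_cardinality typ Bs Ts = do {
     count_types \<leftarrow> for_each (\<lambda>B m. do { T \<leftarrow> op (typ B); incr T m }) Bs [];
     check_all (\<lambda>(T, n). do { c \<leftarrow> count T count_types; eq_atom c n }) Ts }"

definition ports_count :: "('q \<Rightarrow> 'p) \<Rightarrow> 'q list \<Rightarrow> ('p \<times> nat) list timed" where
  "ports_count gen k = for_each (\<lambda>q m. do { p \<leftarrow> op (gen q); incr p m }) k []"

definition matches_motif :: "('p \<times> nat) list \<Rightarrow> 'p motif_list \<Rightarrow> bool timed" where
  "matches_motif pc \<Gamma> = do {
     sub \<leftarrow> check_all (\<lambda>e. has_key (fst e) pc) \<Gamma>;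
     sup \<leftarrow> check_all (\<lambda>e. has_key (fst e) \<Gamma>) pc;
     if sub \<and> sup
     then check_all (\<lambda>(p, m, d). do { c \<leftarrow> count p pc; eq_atom c m }) \<Gamma>
     else ret False }"

primrec find_motif :: "('p \<times> nat) list \<Rightarrow> 'p motif_list list \<Rightarrow> 'p motif_list option timed" where
  "find_motif pc [] = step (ret None)"
| "find_motif pc (\<Gamma> # \<Gamma>s) =
     step (do { b \<leftarrow> matches_motif pc \<Gamma>; if b then ret (Some \<Gamma>) else find_motif pc \<Gamma>s })"

type_synonym ('q, 'p) part_map = "('p motif_list \<times> 'q list list) list"

primrec empty_parts :: "'p motif_list list \<Rightarrow> ('q, 'p) part_map timed" where
  "empty_parts [] = step (ret [])"
| "empty_parts (\<Gamma> # \<Gamma>s) = step (do { S \<leftarrow> empty_parts \<Gamma>s; ret ((\<Gamma>, []) # S) })"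

primrec add_to_part ::
    "'p motif_list \<Rightarrow> 'q list \<Rightarrow> ('q, 'p) part_map \<Rightarrow> ('q, 'p) part_map timed" where
  "add_to_part \<Gamma> k [] = step (ret [])"
| "add_to_part \<Gamma> k (e # S) =
     step (do {
       b \<leftarrow> eq_list \<Gamma> (fst e);
       if b then ret ((fst e, k # snd e) # S)
       else do { S' \<leftarrow> add_to_part \<Gamma> k S; ret (e # S') } })"

primrec distribute ::
    "('q \<Rightarrow> 'p) \<Rightarrow> 'p motif_list list \<Rightarrow> 'q list list \<Rightarrow> ('q, 'p) part_map
     \<Rightarrow> ('q, 'p) part_map option timed" where
  "distribute gen \<Gamma>s [] S = step (ret (Some S))"
| "distribute gen \<Gamma>s (k # ks) S =
     step (do {
       pc \<leftarrow> ports_count gen k;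
       r \<leftarrow> find_motif pc \<Gamma>s;
       case r of
         None \<Rightarrow> ret None
       | Some \<Gamma> \<Rightarrow> do { S' \<leftarrow> add_to_part \<Gamma> k S; distribute gen \<Gamma>s ks S' } })"

text \<open>
  \<open>None\<close> is the failure value \<open>\<emptyset>\<close> of VerifyMultiplicity; it is kept apart from a successfully
  computed map without keys, which arises if there are neither motifs nor connectors.
\<close>

definition verify_multiplicity ::
    "('q \<Rightarrow> 'p) \<Rightarrow> 'q list list \<Rightarrow> 'p motif_list list \<Rightarrow> ('q, 'p) part_map option timed" where
  "verify_multiplicity gen ks \<Gamma>s = do { S \<leftarrow> empty_parts \<Gamma>s; distribute gen \<Gamma>s ks S }"

definition verify_degree ::
    "('q \<Rightarrow> 'p) \<Rightarrow> 'q list list \<Rightarrow> 'p motif_list \<Rightarrow> bool timed" where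
  "verify_degree gen ks \<Gamma> = do {
     degrees \<leftarrow> for_each (\<lambda>k m. for_each incr k m) ks [];
     check_all (\<lambda>(q, c). do {
       p \<leftarrow> op (gen q);
       r \<leftarrow> lookup eq_atom p \<Gamma>;
       case r of None \<Rightarrow> ret False | Some md \<Rightarrow> eq_atom c (snd md) }) degrees }"

definition verify_architecture ::
    "('b \<Rightarrow> 't) \<Rightarrow> ('q \<Rightarrow> 'p) \<Rightarrow> ('b, 'q, 't, 'p) input \<Rightarrow> bool timed" where
  "verify_architecture typ gen I = do {
     card_ok \<leftarrow> verify_cardinality typ (in_components I) (in_types I);
     if \<not> card_ok then ret False
     else do {
       r \<leftarrow> verify_multiplicity gen (in_config I) (in_motifs I);
       case r of
         None \<Rightarrow> ret False
       | Some S \<Rightarrow>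
           check_all (\<lambda>\<Gamma>. do {
             ks \<leftarrow> lookup eq_list \<Gamma> S;
             verify_degree gen (the ks) \<Gamma> }) (in_motifs I) } }"

text \<open>The abstract part (set of connectors) that a computed map assigns to a motif.\<close>

definition part_of :: "('q, 'p) part_map \<Rightarrow> 'p motif \<Rightarrow> 'q set set" where
  "part_of S \<Gamma> = (\<Union>(\<Gamma>', ks)\<in>{e \<in> set S. map_of (fst e) = \<Gamma>}. set ` set ks)"

end

theory Submission
  imports Defs
begin

text \<open>
  Multiplicities are positive, so a connector satisfying the multiplicity constraints of a motif has
  exactly the generic ports of that motif; since motifs with equal generic ports differ in some
  multiplicity, a connector satisfies the constraints of at most one motif. The partition is
  therefore forced, and the greedy choice of the first matching motif finds it. The degree check
  sees participating instances only, which is why idle instances have to be excluded to obtain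
  conformance. The running time is polynomial because no map ever has more entries than the input
  has items.
\<close>


section \<open>Values\<close>

text \<open>The closed form of the computed part map presupposes distinct motif lists, whereas the
  time bound is claimed for every value of the input type. The running-time half therefore rests on
  two weaker invariants of \<open>distribute\<close>: the keys of the part map stay fixed, and the
  connectors stored in it never weigh more than those received. On the correctness side, a condition
  imposed motif by motif holds for some partition exactly when every connector fits a motif and the
  condition holds for the forced parts. Conformance and the verdict are thus compared on the same
  parts, one port instance at a time. The bound has degree 4: loops and map traversals nest at most
  four deep, and each level is charged the full input size.\<close>

lemma val_bind_timed [simp]: "val (bind_timed m f) = val (f (val m))"
  and time_bind_timed [simp]: "time (bind_timed m f) = time m + time (f (val m))"
  and val_ret [simp]: "val (ret x) = x"
  and time_ret [simp]: "time (ret x) = 0"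
  and val_step [simp]: "val (step m) = val m"
  and time_step [simp]: "time (step m) = Suc (time m)"
  and val_op [simp]: "val (op x) = x"
  and time_op [simp]: "time (op x) = 1"
  and val_eq_atom [simp]: "val (eq_atom y z) = (y = z)"
  and time_eq_atom [simp]: "time (eq_atom y z) = 1"
  by (simp_all add: bind_timed_def ret_def step_def op_def eq_atom_def)

lemma val_for_each: "val (for_each f xs s) = fold (\<lambda>x s. val (f x s)) xs s"
  by (induction xs arbitrary: s) simp_all

lemma val_check_all [simp]: "val (check_all P xs) \<longleftrightarrow> (\<forall>x\<in>set xs. val (P x))"
  by (induction xs) simp_all

lemma val_eq_list [simp]: "val (eq_list xs ys) \<longleftrightarrow> xs = ys"
  by (induction xs ys rule: eq_list.induct) simp_all

lemma val_lookup:
  assumes "\<And>x y. val (eq x y) \<longleftrightarrow> x = y"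
  shows "val (lookup eq k m) = map_of m k"
  by (induction m) (auto simp: assms)

lemma val_lookup_eq_atom [simp]: "val (lookup eq_atom k m) = map_of m k"
  and val_lookup_eq_list [simp]: "val (lookup eq_list ks M) = map_of M ks"
  by (simp_all add: val_lookup)

lemma val_has_key [simp]: "val (has_key k m) \<longleftrightarrow> k \<in> fst ` set m"
  by (auto simp: has_key_def simp flip: dom_map_of_conv_image_fst)

lemma val_count [simp]: "val (count k m) = (case map_of m k of None \<Rightarrow> 0 | Some c \<Rightarrow> c)"
  by (simp add: count_def)

section \<open>Counting maps\<close>

lemma keys_incr: "fst ` set (val (incr k m)) = insert k (fst ` set m)"
  by (induction m) auto

lemma distinct_keys_incr: "distinct (map fst m) \<Longrightarrow> distinct (map fst (val (incr k m)))"
proof (induction m)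
  case (Cons e m)
  have "fst e \<notin> set (map fst (val (incr k m)))" if "k \<noteq> fst e"
    using Cons.prems that keys_incr[of k m] by auto
  with Cons show ?case by auto
qed simp

lemma map_of_incr:
  "map_of (val (incr k m)) =
     (map_of m)(k \<mapsto> Suc (case map_of m k of None \<Rightarrow> 0 | Some c \<Rightarrow> c))"
  by (induction m) (auto simp: fun_eq_iff)

text \<open>Common value of the three counting loops of the algorithm (types, generic ports, port
  instances). Since \<open>fold\<close> treats the last element last, its properties follow by
  induction from the end of the list.\<close>

definition tally :: "'a list \<Rightarrow> ('a \<times> nat) list" where
  "tally xs = fold (\<lambda>x m. val (incr x m)) xs []"

lemma tally_snoc: "tally (xs @ [x]) = val (incr x (tally xs))"
  by (simp add: tally_def)

lemma keys_tally [simp]: "fst ` set (tally xs) = set xs"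
  by (induction xs rule: rev_induct) (simp_all add: tally_snoc keys_incr, simp add: tally_def)

lemma distinct_keys_tally [simp]: "distinct (map fst (tally xs))"
  by (induction xs rule: rev_induct)
    (simp_all add: tally_snoc distinct_keys_incr, simp add: tally_def)

lemma map_of_tally:
  "map_of (tally xs) x = (if x \<in> set xs then Some (count_list xs x) else None)"
proof (induction xs rule: rev_induct)
  case Nil
  show ?case by (simp add: tally_def)
next
  case (snoc y xs)
  then show ?case by (auto simp: tally_snoc map_of_incr)
qed

lemma set_tally: "set (tally xs) = (\<lambda>x. (x, count_list xs x)) ` set xs"
proof -
  have "(x, c) \<in> set (tally xs) \<longleftrightarrow> x \<in> set xs \<and> c = count_list xs x" for x c
    using map_of_eq_Some_iff[OF distinct_keys_tally, of xs x c] map_of_tally[of xs x]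
    by (auto split: if_splits)
  then show ?thesis by auto
qed

text \<open>Reading a missing key as zero agrees with \<open>count_list\<close>, which vanishes
  outside the list, so no case distinction on the presence of a key survives.\<close>

lemma count_tally:
  "(case map_of (tally xs) x of None \<Rightarrow> 0 | Some c \<Rightarrow> c) = count_list xs x"
  by (simp add: map_of_tally)

text \<open>Passage from lists to sets: without repetitions, positions in the list and elements of
  its set correspond one to one.\<close>

lemma count_list_map_distinct:
  assumes "distinct xs"
  shows "count_list (map f xs) y = card {x \<in> set xs. f x = y}"
proof -
  have "count_list (map f xs) y = length (filter (\<lambda>x. f x = y) xs)"
    by (induction xs) auto
  also have "\<dots> = card {x \<in> set xs. f x = y}"
    using assms by (simp add: distinct_length_filter Collect_conj_eq Int_commute)
  finally show ?thesis .
qed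

text \<open>A connector without repetitions contributes at most one occurrence of \<open>q\<close>,
  and distinct underlying sets prevent two lists from being counted as one connector.\<close>

lemma count_list_concat_distinct:
  assumes "\<forall>k\<in>set ks. distinct k" "distinct (map set ks)"
  shows "count_list (concat ks) q = card {k \<in> set ` set ks. q \<in> k}"
  using assms
proof (induction ks)
  case (Cons k ks)
  have "{x \<in> set k. x = q} = (if q \<in> set k then {q} else {})"
    by auto
  then have "count_list k q = (if q \<in> set k then 1 else 0)"
    using count_list_map_distinct[of k "\<lambda>x. x" q] Cons.prems(1) by simp
  moreover have "{k' \<in> set ` set (k # ks). q \<in> k'} =
      (if q \<in> set k then insert (set k) {k' \<in> set ` set ks. q \<in> k'}
       else {k' \<in> set ` set ks. q \<in> k'})"
    by auto
  ultimately show ?case using Cons by simp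
qed simp

section \<open>Closed forms of the values of the algorithm\<close>

lemma val_verify_cardinality:
  "val (verify_cardinality typ Bs Ts) \<longleftrightarrow> (\<forall>(T, n)\<in>set Ts. count_list (map typ Bs) T = n)"
proof -
  have "fold (\<lambda>B m. val (incr (typ B) m)) Bs [] = tally (map typ Bs)"
    by (simp add: tally_def fold_map comp_def)
  then show ?thesis
    by (simp add: verify_cardinality_def val_for_each count_tally case_prod_beta)
qed

lemma val_ports_count: "val (ports_count gen k) = tally (map gen k)"
  by (simp add: ports_count_def val_for_each tally_def fold_map comp_def)

abbreviation (input) matches :: "('q \<Rightarrow> 'p) \<Rightarrow> 'q list \<Rightarrow> 'p motif_list \<Rightarrow> bool" where
  "matches gen k \<Gamma> \<equiv> val (matches_motif (tally (map gen k)) \<Gamma>)"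

lemma val_matches_motif:
  "matches gen k \<Gamma> \<longleftrightarrow> fst ` set \<Gamma> = gen ` set k \<and>
     (\<forall>(p, m, d)\<in>set \<Gamma>. count_list (map gen k) p = m)"
proof -
  \<comment> \<open>The key set of the tally is kept unsimplified below, so that the two membership
    loops appear as the two inclusions between the same pair of sets.\<close>
  have keys: "gen ` set k = fst ` set (tally (map gen k))"
    by simp
  have "matches gen k \<Gamma> \<longleftrightarrow>
     fst ` set \<Gamma> \<subseteq> fst ` set (tally (map gen k)) \<and> fst ` set (tally (map gen k)) \<subseteq> fst ` set \<Gamma> \<and>
     (\<forall>(p, m, d)\<in>set \<Gamma>. count_list (map gen k) p = m)"
    by (simp add: matches_motif_def count_tally case_prod_beta image_subset_iff del: keys_tally)
  then show ?thesis
    by (simp only: keys set_eq_subset conj_assoc)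
qed

lemma val_find_motif: "val (find_motif pc \<Gamma>s) = List.find (\<lambda>\<Gamma>. val (matches_motif pc \<Gamma>)) \<Gamma>s"
  by (induction \<Gamma>s) simp_all

lemma val_empty_parts: "val (empty_parts \<Gamma>s) = map (\<lambda>\<Gamma>. (\<Gamma>, [])) \<Gamma>s"
  by (induction \<Gamma>s) simp_all

text \<open>A part map is written as the graph of a function \<open>g\<close> on a fixed key list,
  which makes the insertion a pointwise update of \<open>g\<close>. Only the first entry with the
  key is changed, hence the distinctness.\<close>

lemma val_add_to_part:
  "distinct \<Gamma>s \<Longrightarrow> val (add_to_part \<Gamma> k (map (\<lambda>\<Gamma>'. (\<Gamma>', g \<Gamma>')) \<Gamma>s)) =
     map (\<lambda>\<Gamma>'. (\<Gamma>', if \<Gamma>' = \<Gamma> then k # g \<Gamma>' else g \<Gamma>')) \<Gamma>s"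
  by (induction \<Gamma>s) (auto intro!: map_cong)

text \<open>The accumulated parts \<open>g\<close> are arbitrary for the sake of the induction.
  Connectors are prepended to their part, which accounts for \<open>rev\<close>.\<close>

lemma val_distribute:
  assumes "distinct \<Gamma>s"
  shows "val (distribute gen \<Gamma>s ks (map (\<lambda>\<Gamma>. (\<Gamma>, g \<Gamma>)) \<Gamma>s)) =
     (if \<forall>k\<in>set ks. \<exists>\<Gamma>\<in>set \<Gamma>s. matches gen k \<Gamma>
      then Some (map (\<lambda>\<Gamma>. (\<Gamma>, rev (filter (\<lambda>k. List.find (matches gen k) \<Gamma>s = Some \<Gamma>) ks) @ g \<Gamma>)) \<Gamma>s)
      else None)"
proof (induction ks arbitrary: g)
  case (Cons k ks)
  show ?case
  proof (cases "List.find (matches gen k) \<Gamma>s")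
    case None
    then have "\<not> (\<exists>\<Gamma>\<in>set \<Gamma>s. matches gen k \<Gamma>)"
      by (auto simp: find_None_iff)
    with None show ?thesis
      by (simp add: val_ports_count val_find_motif)
  next
    case (Some \<Gamma>)
    then have "\<exists>\<Gamma>\<in>set \<Gamma>s. matches gen k \<Gamma>"
      by (metis find_None_iff option.distinct(1))
    with Some show ?thesis
      by (auto simp: val_ports_count val_find_motif val_add_to_part[OF assms] Cons.IH)
  qed
qed simp

lemma val_verify_multiplicity:
  assumes "distinct \<Gamma>s"
  shows "val (verify_multiplicity gen ks \<Gamma>s) =
     (if \<forall>k\<in>set ks. \<exists>\<Gamma>\<in>set \<Gamma>s. matches gen k \<Gamma>
      then Some (map (\<lambda>\<Gamma>. (\<Gamma>, rev (filter (\<lambda>k. List.find (matches gen k) \<Gamma>s = Some \<Gamma>) ks))) \<Gamma>s)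
      else None)"
  using val_distribute[OF assms, of gen ks "\<lambda>_. []"]
  by (simp add: verify_multiplicity_def val_empty_parts)

lemma val_verify_degree:
  "val (verify_degree gen ks \<Gamma>) \<longleftrightarrow>
     (\<forall>q\<in>set (concat ks). \<exists>md. map_of \<Gamma> (gen q) = Some md \<and> count_list (concat ks) q = snd md)"
proof -
  \<comment> \<open>The nested loop over connectors and their ports is one counting loop over the
    concatenation.\<close>
  have "fold (\<lambda>k. fold (\<lambda>q m. val (incr q m)) k) ks s = fold (\<lambda>q m. val (incr q m)) (concat ks) s"
    for s :: "('a \<times> nat) list"
    by (induction ks arbitrary: s) simp_all
  then have "val (for_each (\<lambda>k m. for_each incr k m) ks []) = tally (concat ks)"
    by (simp add: val_for_each tally_def)
  moreover have "val (case r of None \<Rightarrow> ret False | Some md \<Rightarrow> eq_atom c (snd md)) \<longleftrightarrow>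
      (\<exists>md. r = Some md \<and> c = snd md)" for r :: "(nat \<times> nat) option" and c
    by (cases r) auto
  ultimately show ?thesis
    by (simp add: verify_degree_def set_tally)
qed


section \<open>Correctness\<close>

locale represented_instance =
  fixes A :: "('b, 'q, 't, 'p) architecture" and D :: "('t, 'p) diagram"
    and I :: "('b, 'q, 't, 'p) input"
  assumes diagram: "simple_diagram D"
    and over: "architecture_over D A"
    and repr: "represents I A D"
begin

section \<open>From the input lists to the architecture and the diagram\<close>

lemma verify_cardinality_correct:
  "val (verify_cardinality (typeof A) (in_components I) (in_types I)) \<longleftrightarrow> cardinalities_hold A D"
proof -
  have "count_list (map (typeof A) (in_components I)) T = card {B \<in> components A. typeof A B = T}" for T
    using repr count_list_map_distinct[of "in_components I" "typeof A" T]
    by (simp add: represents_def)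
  moreover have "(\<forall>(T, n)\<in>set (in_types I). f T = n) \<longleftrightarrow> (\<forall>T\<in>types D. f T = cardinality D T)"
    for f
  proof -
    have "\<forall>x\<in>set (in_types I). snd x = cardinality D (fst x)"
      and types: "types D = fst ` set (in_types I)"
      using repr by (simp_all add: represents_def case_prod_beta)
    then have "(\<forall>(T, n)\<in>set (in_types I). f T = n) \<longleftrightarrow>
        (\<forall>x\<in>set (in_types I). f (fst x) = cardinality D (fst x))"
      by (simp add: case_prod_beta)
    then show ?thesis by (simp add: types)
  qed
  ultimately show ?thesis
    by (simp add: val_verify_cardinality cardinalities_hold_def)
qed

text \<open>Distinctness of \<open>map map_of (in_motifs I)\<close> splits into distinctness of the
  motif lists and injectivity of \<open>map_of\<close> on them, so each motif is presented by
  exactly one list.\<close>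

lemma distinct_motifs: "distinct (in_motifs I)"
  and inj_map_of: "inj_on map_of (set (in_motifs I))"
  and motifs_eq: "motifs D = map_of ` set (in_motifs I)"
  and config_eq: "config A = set ` set (in_config I)"
  using repr by (auto simp: represents_def distinct_map)

text \<open>Connectors consist of ports of components of \<open>A\<close>; inside a connector, being
  an instance of \<open>p\<close> is therefore a matter of \<open>generic A\<close> alone.\<close>

lemma port_instances_config:
  assumes "k \<in> config A"
  shows "k \<inter> port_instances A p = {q \<in> k. generic A q = p}"
  using over assms unfolding architecture_over_def port_instances_def by blast

text \<open>The constraint asks for an inclusion of generic ports, the algorithm compares key sets
  for equality. The gap closes because an empty fibre over a port of the motif would have
  cardinality 0, against the positive multiplicity.\<close>

lemma multiplicities_hold_iff:
  assumes "k \<in> config A" "\<Gamma> \<in> motifs D"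
  shows "multiplicities_hold A \<Gamma> k \<longleftrightarrow> generic A ` k = gconn \<Gamma> \<and>
     (\<forall>p\<in>gconn \<Gamma>. card {q \<in> k. generic A q = p} = mult \<Gamma> p)"
proof -
  have "p \<in> generic A ` k" if "multiplicities_hold A \<Gamma> k" "p \<in> gconn \<Gamma>" for p
  proof -
    have "card {q \<in> k. generic A q = p} = mult \<Gamma> p"
      using that unfolding multiplicities_hold_def port_instances_config[OF assms(1)] by blast
    moreover have "mult \<Gamma> p > 0"
      using diagram assms(2) that(2) unfolding simple_diagram_def by blast
    ultimately have "card {q \<in> k. generic A q = p} > 0" by simp
    then have "{q \<in> k. generic A q = p} \<noteq> {}" by (metis card.empty less_irrefl)
    then show ?thesis by blast
  qed
  then show ?thesis
    using port_instances_config[OF assms(1)] by (auto simp: multiplicities_hold_def)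
qed

text \<open>The generic connector and the multiplicities are read off \<open>k\<close> itself: they
  are the image and the fibre sizes of \<open>generic A\<close> on \<open>k\<close>.\<close>

lemma multiplicities_hold_unique:
  assumes "k \<in> config A" "\<Gamma> \<in> motifs D" "\<Gamma>' \<in> motifs D"
    and "multiplicities_hold A \<Gamma> k" "multiplicities_hold A \<Gamma>' k"
  shows "\<Gamma> = \<Gamma>'"
proof (rule ccontr)
  assume "\<Gamma> \<noteq> \<Gamma>'"
  have \<Gamma>: "generic A ` k = gconn \<Gamma>" "\<And>p. p \<in> gconn \<Gamma> \<Longrightarrow> card {q \<in> k. generic A q = p} = mult \<Gamma> p"
    using assms(4) multiplicities_hold_iff[OF assms(1,2)] by auto
  have \<Gamma>': "generic A ` k = gconn \<Gamma>'"
    "\<And>p. p \<in> gconn \<Gamma>' \<Longrightarrow> card {q \<in> k. generic A q = p} = mult \<Gamma>' p"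
    using assms(5) multiplicities_hold_iff[OF assms(1,3)] by auto
  have same: "gconn \<Gamma> = gconn \<Gamma>'"
    using \<Gamma>(1) \<Gamma>'(1) by simp
  then obtain p where "p \<in> gconn \<Gamma>" "mult \<Gamma> p \<noteq> mult \<Gamma>' p"
    using diagram assms(2,3) \<open>\<Gamma> \<noteq> \<Gamma>'\<close> unfolding simple_diagram_def by blast
  then show False
    using \<Gamma>(2)[of p] \<Gamma>'(2)[of p] same by simp
qed

lemma matches_iff:
  assumes "k \<in> set (in_config I)" "\<Gamma> \<in> set (in_motifs I)"
  shows "matches (generic A) k \<Gamma> \<longleftrightarrow> multiplicities_hold A (map_of \<Gamma>) (set k)"
proof -
  have k: "distinct k" and \<Gamma>: "distinct (map fst \<Gamma>)"
    using repr assms by (auto simp: represents_def)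
  \<comment> \<open>With distinct keys, every triple of the list is the value of
    \<open>map_of\<close> at its port, so its second entry is \<open>mult\<close>.\<close>
  have "(\<forall>(p, m, d)\<in>set \<Gamma>. f p = m) \<longleftrightarrow> (\<forall>p\<in>fst ` set \<Gamma>. f p = mult (map_of \<Gamma>) p)" for f
    using \<Gamma> by (auto simp: mult_def)
  moreover have "gconn (map_of \<Gamma>) = fst ` set \<Gamma>"
    by (simp add: gconn_def dom_map_of_conv_image_fst)
  ultimately show ?thesis
    using assms multiplicities_hold_iff[of "set k" "map_of \<Gamma>"]
    by (auto simp: val_matches_motif count_list_map_distinct[OF k] config_eq motifs_eq)
qed

section \<open>The forced partition\<close>

definition forced_part :: "'p motif \<Rightarrow> 'q set set" where
  "forced_part \<Gamma> = {k \<in> config A. multiplicities_hold A \<Gamma> k}"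

text \<open>Covering puts a connector of \<open>forced_part \<Gamma>\<close> into some part, and
  uniqueness of its motif shows that this is the part of \<Gamma>. The equality is restricted to
  \<open>motifs D\<close> because \<open>part\<close> is unconstrained elsewhere.\<close>

lemma motif_partition_iff:
  "motif_partition A D part \<longleftrightarrow>
     (\<forall>k\<in>config A. \<exists>\<Gamma>\<in>motifs D. multiplicities_hold A \<Gamma> k) \<and>
     (\<forall>\<Gamma>\<in>motifs D. part \<Gamma> = forced_part \<Gamma>)"
proof (intro iffI conjI ballI)
  assume part: "motif_partition A D part"
  then show "\<exists>\<Gamma>\<in>motifs D. multiplicities_hold A \<Gamma> k" if "k \<in> config A" for k
    using that unfolding motif_partition_def by blast
  show "part \<Gamma> = forced_part \<Gamma>" if "\<Gamma> \<in> motifs D" for \<Gamma>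
  proof
    show "part \<Gamma> \<subseteq> forced_part \<Gamma>"
      using part that unfolding motif_partition_def forced_part_def by blast
    show "forced_part \<Gamma> \<subseteq> part \<Gamma>"
    proof
      fix k assume "k \<in> forced_part \<Gamma>"
      then have k: "k \<in> config A" "multiplicities_hold A \<Gamma> k"
        by (auto simp: forced_part_def)
      then obtain \<Gamma>' where "\<Gamma>' \<in> motifs D" "k \<in> part \<Gamma>'"
        using part unfolding motif_partition_def by blast
      moreover from this have "\<Gamma>' = \<Gamma>"
        using multiplicities_hold_unique[OF k(1)] k(2) that part
        unfolding motif_partition_def by blast
      ultimately show "k \<in> part \<Gamma>" by simp
    qed
  qed
next
  assume *: "(\<forall>k\<in>config A. \<exists>\<Gamma>\<in>motifs D. multiplicities_hold A \<Gamma> k) \<and>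
     (\<forall>\<Gamma>\<in>motifs D. part \<Gamma> = forced_part \<Gamma>)"
  then have "(\<Union>\<Gamma>\<in>motifs D. part \<Gamma>) = config A"
    by (auto simp: forced_part_def)
  moreover have "disjoint_family_on part (motifs D)"
    using * multiplicities_hold_unique
    unfolding disjoint_family_on_def forced_part_def by blast
  ultimately show "motif_partition A D part"
    using * by (auto simp: motif_partition_def forced_part_def)
qed

text \<open>Stated for arbitrary \<open>Q\<close> so that it serves both
  \<open>degrees_hold\<close>, for conformance, and \<open>participant_degrees_hold\<close>, for the
  algorithm.\<close>

lemma motif_partition_exists_iff:
  "(\<exists>part. motif_partition A D part \<and> (\<forall>\<Gamma>\<in>motifs D. Q \<Gamma> (part \<Gamma>))) \<longleftrightarrow>
     (\<forall>k\<in>config A. \<exists>\<Gamma>\<in>motifs D. multiplicities_hold A \<Gamma> k) \<and>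
     (\<forall>\<Gamma>\<in>motifs D. Q \<Gamma> (forced_part \<Gamma>))"
proof
  assume "(\<forall>k\<in>config A. \<exists>\<Gamma>\<in>motifs D. multiplicities_hold A \<Gamma> k) \<and>
     (\<forall>\<Gamma>\<in>motifs D. Q \<Gamma> (forced_part \<Gamma>))"
  then show "\<exists>part. motif_partition A D part \<and> (\<forall>\<Gamma>\<in>motifs D. Q \<Gamma> (part \<Gamma>))"
    by (intro exI[of _ forced_part]) (simp add: motif_partition_iff)
next
  assume "\<exists>part. motif_partition A D part \<and> (\<forall>\<Gamma>\<in>motifs D. Q \<Gamma> (part \<Gamma>))"
  then obtain part where "motif_partition A D part" "\<forall>\<Gamma>\<in>motifs D. Q \<Gamma> (part \<Gamma>)"
    by blast
  then show "(\<forall>k\<in>config A. \<exists>\<Gamma>\<in>motifs D. multiplicities_hold A \<Gamma> k) \<and>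
     (\<forall>\<Gamma>\<in>motifs D. Q \<Gamma> (forced_part \<Gamma>))"
    unfolding motif_partition_iff by simp
qed

section \<open>The computed parts and the verdict\<close>

definition connectors_of :: "'p motif_list \<Rightarrow> 'q list list" where
  "connectors_of \<Gamma> = rev (filter
     (\<lambda>k. List.find (matches (generic A) k) (in_motifs I) = Some \<Gamma>) (in_config I))"

lemma verify_multiplicity_eq:
  "val (verify_multiplicity (generic A) (in_config I) (in_motifs I)) =
     (if \<forall>k\<in>config A. \<exists>\<Gamma>\<in>motifs D. multiplicities_hold A \<Gamma> k
      then Some (map (\<lambda>\<Gamma>. (\<Gamma>, connectors_of \<Gamma>)) (in_motifs I)) else None)"
proof -
  have "(\<forall>k\<in>set (in_config I). \<exists>\<Gamma>\<in>set (in_motifs I). matches (generic A) k \<Gamma>) \<longleftrightarrow>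
     (\<forall>k\<in>config A. \<exists>\<Gamma>\<in>motifs D. multiplicities_hold A \<Gamma> k)"
    by (simp add: config_eq motifs_eq matches_iff)
  then show ?thesis
    by (simp add: val_verify_multiplicity[OF distinct_motifs] connectors_of_def)
qed

lemma set_connectors_of:
  assumes "\<Gamma> \<in> set (in_motifs I)"
  shows "set ` set (connectors_of \<Gamma>) = forced_part (map_of \<Gamma>)"
proof -
  have "List.find (matches (generic A) k) (in_motifs I) = Some \<Gamma> \<longleftrightarrow>
      multiplicities_hold A (map_of \<Gamma>) (set k)" if k: "k \<in> set (in_config I)" for k
  proof
    assume "List.find (matches (generic A) k) (in_motifs I) = Some \<Gamma>"
    then have "matches (generic A) k \<Gamma>"
      by (auto simp: find_Some_iff)
    then show "multiplicities_hold A (map_of \<Gamma>) (set k)"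
      using matches_iff[OF k assms] by simp
  next
    assume hold: "multiplicities_hold A (map_of \<Gamma>) (set k)"
    then have "matches (generic A) k \<Gamma>"
      using matches_iff[OF k assms] by simp
    \<comment> \<open>A priori the search may stop at an earlier list. Uniqueness identifies the two
      motifs, and injectivity of \<open>map_of\<close> then identifies the two lists.\<close>
    then obtain \<Gamma>' where found: "List.find (matches (generic A) k) (in_motifs I) = Some \<Gamma>'"
      using assms by (metis find_None_iff not_None_eq)
    then have \<Gamma>': "\<Gamma>' \<in> set (in_motifs I)" "matches (generic A) k \<Gamma>'"
      by (auto simp: find_Some_iff)
    have "map_of \<Gamma>' = map_of \<Gamma>"
      by (rule multiplicities_hold_unique[of "set k"])
        (use \<Gamma>' assms k hold matches_iff[OF k \<Gamma>'(1)] in \<open>auto simp: config_eq motifs_eq\<close>)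
    then show "List.find (matches (generic A) k) (in_motifs I) = Some \<Gamma>"
      using found inj_map_of \<Gamma>'(1) assms by (auto dest: inj_onD)
  qed
  then show ?thesis
    by (auto simp: connectors_of_def forced_part_def config_eq)
qed

lemma part_of_connectors:
  assumes "\<Gamma> \<in> motifs D"
  shows "part_of (map (\<lambda>\<Gamma>. (\<Gamma>, connectors_of \<Gamma>)) (in_motifs I)) \<Gamma> = forced_part \<Gamma>"
proof -
  obtain \<Gamma>l where \<Gamma>l: "\<Gamma>l \<in> set (in_motifs I)" "\<Gamma> = map_of \<Gamma>l"
    using assms motifs_eq by blast
  \<comment> \<open>Injectivity of \<open>map_of\<close> leaves a single entry in the union that
    defines \<open>part_of\<close>.\<close>
  have "{e \<in> set (map (\<lambda>\<Gamma>. (\<Gamma>, connectors_of \<Gamma>)) (in_motifs I)). map_of (fst e) = \<Gamma>} =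
      {(\<Gamma>l, connectors_of \<Gamma>l)}"
    using \<Gamma>l inj_map_of by (auto dest: inj_onD)
  then show ?thesis
    using set_connectors_of[OF \<Gamma>l(1)] \<Gamma>l(2) unfolding part_of_def by simp
qed

lemma verify_degree_correct:
  assumes "\<Gamma> \<in> set (in_motifs I)"
  shows "val (verify_degree (generic A) (connectors_of \<Gamma>) \<Gamma>) \<longleftrightarrow>
     participant_degrees_hold A (map_of \<Gamma>) (forced_part (map_of \<Gamma>))"
proof -
  let ?ks = "connectors_of \<Gamma>" and ?K = "forced_part (map_of \<Gamma>)"
  have "distinct (map set (in_config I))" "\<forall>k\<in>set (in_config I). distinct k"
    using repr by (auto simp: represents_def)
  then have "distinct (map set ?ks)" "\<forall>k\<in>set ?ks. distinct k"
    by (auto simp: connectors_of_def rev_map[symmetric] distinct_map_filter)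
  then have count: "count_list (concat ?ks) q = card {k \<in> ?K. q \<in> k}" for q
    by (simp add: count_list_concat_distinct set_connectors_of[OF assms])
  have participants: "set (concat ?ks) = \<Union>?K"
    using set_connectors_of[OF assms] by simp
  \<comment> \<open>For a participating port the lookup in \<Gamma> always succeeds, so the failing
    branch for a missing key is never taken. The same facts let the range over generic ports and
    their instances collapse to a range over participating ports.\<close>
  have instances: "generic A q \<in> gconn (map_of \<Gamma>)" "q \<in> port_instances A (generic A q)"
    if "q \<in> \<Union>?K" for q
    using that over
    by (auto simp: forced_part_def multiplicities_hold_def architecture_over_def port_instances_def)
       blast
  have "(\<exists>md. map_of \<Gamma> (generic A q) = Some md \<and> c = snd md) \<longleftrightarrow> c = deg (map_of \<Gamma>) (generic A q)"
    if "q \<in> \<Union>?K" for q c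
    using instances(1)[OF that] by (auto simp: gconn_def deg_def)
  then have "val (verify_degree (generic A) ?ks \<Gamma>) \<longleftrightarrow>
      (\<forall>q\<in>\<Union>?K. card {k \<in> ?K. q \<in> k} = deg (map_of \<Gamma>) (generic A q))"
    unfolding val_verify_degree participants count by blast
  also have "\<dots> \<longleftrightarrow> participant_degrees_hold A (map_of \<Gamma>) ?K"
    using instances unfolding participant_degrees_hold_def port_instances_def by blast
  finally show ?thesis .
qed

lemma lookup_connectors:
  "\<Gamma> \<in> set (in_motifs I) \<Longrightarrow>
     map_of (map (\<lambda>\<Gamma>. (\<Gamma>, connectors_of \<Gamma>)) (in_motifs I)) \<Gamma> = Some (connectors_of \<Gamma>)"
  by (simp add: map_of_map_restrict)

lemma verify_architecture_correct:
  "val (verify_architecture (typeof A) (generic A) I) \<longleftrightarrow>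
     cardinalities_hold A D \<and>
     (\<exists>part. motif_partition A D part \<and>
       (\<forall>\<Gamma>\<in>motifs D. participant_degrees_hold A \<Gamma> (part \<Gamma>)))"
  unfolding motif_partition_exists_iff[of "participant_degrees_hold A"]
  by (simp add: verify_architecture_def verify_cardinality_correct verify_multiplicity_eq
      lookup_connectors verify_degree_correct motifs_eq)

text \<open>Only the degree conditions differ. An instance that occurs in the forced part is checked
  by the algorithm; one that does not has count 0, so its degree equation says that the degree is 0,
  which is the content of \<open>no_idle_instance\<close> for it.\<close>

lemma conforms_iff:
  "conforms A D \<longleftrightarrow> val (verify_architecture (typeof A) (generic A) I) \<and> no_idle_instance A D"
proof -
  have "degrees_hold A \<Gamma> (forced_part \<Gamma>) \<longleftrightarrow>
      participant_degrees_hold A \<Gamma> (forced_part \<Gamma>) \<and>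
      (\<forall>p\<in>gconn \<Gamma>. deg \<Gamma> p > 0 \<longrightarrow>
        (\<forall>q\<in>port_instances A p. \<exists>k\<in>config A. q \<in> k \<and> multiplicities_hold A \<Gamma> k))" for \<Gamma>
  proof -
    have *: "(card {k \<in> forced_part \<Gamma>. q \<in> k} = d) \<longleftrightarrow>
        (q \<in> \<Union>(forced_part \<Gamma>) \<longrightarrow> card {k \<in> forced_part \<Gamma>. q \<in> k} = d) \<and>
        (d > 0 \<longrightarrow> (\<exists>k\<in>config A. q \<in> k \<and> multiplicities_hold A \<Gamma> k))" for q d
    proof (cases "q \<in> \<Union>(forced_part \<Gamma>)")
      case True
      then show ?thesis by (auto simp: forced_part_def)
    next
      case False
      then have "{k \<in> forced_part \<Gamma>. q \<in> k} = {}" by blast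
      then have "card {k \<in> forced_part \<Gamma>. q \<in> k} = 0" by (simp only: card.empty)
      moreover have "\<not> (\<exists>k\<in>config A. q \<in> k \<and> multiplicities_hold A \<Gamma> k)"
        using False by (auto simp: forced_part_def)
      ultimately show ?thesis using False by auto
    qed
    show ?thesis
      unfolding degrees_hold_def participant_degrees_hold_def
      by (subst *) blast
  qed
  then have "(\<forall>\<Gamma>\<in>motifs D. degrees_hold A \<Gamma> (forced_part \<Gamma>)) \<longleftrightarrow>
      (\<forall>\<Gamma>\<in>motifs D. participant_degrees_hold A \<Gamma> (forced_part \<Gamma>)) \<and> no_idle_instance A D"
    unfolding no_idle_instance_def by (simp only: ball_conj_distrib)
  then show ?thesis
    unfolding conforms_def verify_architecture_correct
      motif_partition_exists_iff[of "participant_degrees_hold A"]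
      motif_partition_exists_iff[of "degrees_hold A"]
    by simp
qed

end


section \<open>Running time\<close>

text \<open>Each element pays for its test and for one loop call, hence \<open>Suc c\<close>; the
  outer \<open>Suc\<close> is the call on the empty list. Stopping early only saves time.\<close>

lemma time_check_all:
  "(\<And>x. x \<in> set xs \<Longrightarrow> time (P x) \<le> c) \<Longrightarrow> time (check_all P xs) \<le> Suc (length xs * Suc c)"
proof (induction xs)
  case (Cons x xs)
  have "time (P x) \<le> c" "time (check_all P xs) \<le> Suc (length xs * Suc c)"
    using Cons by simp_all
  then show ?case by simp
qed simp

lemma time_lookup:
  "(\<And>x. time (eq k x) \<le> c) \<Longrightarrow> time (lookup eq k m) \<le> Suc (length m * Suc c)"
proof (induction m)
  case (Cons e m)
  have "time (eq k (fst e)) \<le> c" "time (lookup eq k m) \<le> Suc (length m * Suc c)"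
    using Cons by simp_all
  then show ?case by simp
qed simp

lemma time_lookup_eq_atom: "time (lookup eq_atom k m) \<le> 2 * length m + 1"
  using time_lookup[of eq_atom k 1 m] by simp

text \<open>The comparison ends with the shorter list, so the first argument alone bounds it. Map
  accesses pass the sought key first, which makes their cost independent of the lengths of the
  stored keys.\<close>

lemma time_eq_list: "time (eq_list xs ys) \<le> 2 * length xs + 1"
  by (induction xs ys rule: eq_list.induct) simp_all

lemma time_has_key: "time (has_key k m) \<le> 2 * length m + 2"
  and time_count: "time (count k m') \<le> 2 * length m' + 2"
  using time_lookup_eq_atom[of k m] time_lookup_eq_atom[of k m']
  by (simp_all add: has_key_def count_def)

lemma time_incr: "time (incr k m) \<le> 2 * length m + 1"
  by (induction m) auto

lemma length_incr: "length (val (incr k m)) \<le> Suc (length m)"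
  by (induction m) auto

lemma length_for_each:
  assumes "\<And>x s. length (val (f x s)) \<le> length s + w x"
  shows "length (val (for_each f xs s)) \<le> length s + sum_list (map w xs)"
proof (induction xs arbitrary: s)
  case (Cons x xs)
  show ?case using assms[of x s] Cons.IH[of "val (f x s)"] by simp
qed simp

text \<open>The cost of the body depends on a state that grows during the loop. Here
  \<open>w x\<close> is the growth allowed to the iteration for \<open>x\<close>, and the budget
  \<open>n\<close> covers the present length plus all growth still to come, so \<open>c\<close> is
  needed only for states within the budget.\<close>

lemma time_for_each:
  assumes "\<And>x s. length (val (f x s)) \<le> length s + w x"
    and "\<And>x s. x \<in> set xs \<Longrightarrow> length s + w x \<le> n \<Longrightarrow> time (f x s) \<le> c"
    and "length s + sum_list (map w xs) \<le> n"
  shows "time (for_each f xs s) \<le> Suc (length xs * Suc c)"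
  using assms(2,3)
proof (induction xs arbitrary: s)
  case (Cons x xs)
  have "time (f x s) \<le> c" using Cons.prems by simp
  moreover have "time (for_each f xs (val (f x s))) \<le> Suc (length xs * Suc c)"
    using Cons.prems assms(1)[of x s] by (intro Cons.IH) auto
  ultimately show ?case by simp
qed simp

section \<open>Time of the cardinality and multiplicity checks\<close>

lemma time_verify_cardinality:
  assumes "length Bs \<le> n" "length Ts \<le> n"
  shows "time (verify_cardinality typ Bs Ts) \<le> 2 + 2 * (n * (2 * n + 4))"
proof -
  let ?f = "\<lambda>B m. do { T \<leftarrow> op (typ B); incr T m }"
  have len: "length (val (?f B m)) \<le> length m + 1" for B m
    using length_incr[of "typ B" m] by simp
  have f: "time (?f B m) \<le> 2 * n + 2" if "length m \<le> n" for B m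
    using time_incr[of "typ B" m] that by simp
  have "time (for_each ?f Bs []) \<le> Suc (length Bs * Suc (2 * n + 2))"
    by (rule time_for_each[where w = "\<lambda>_. 1" and n = n])
      (use len f assms in \<open>auto simp: sum_list_triv\<close>)
  \<comment> \<open>The factor \<open>2 * n + 3\<close> is rounded up so that both loops share one
    bound.\<close>
  also have "\<dots> \<le> Suc (n * (2 * n + 4))"
    using assms by (intro Suc_le_mono[THEN iffD2] mult_le_mono) auto
  finally have t1: "time (for_each ?f Bs []) \<le> Suc (n * (2 * n + 4))" .
  define m where "m = val (for_each ?f Bs [])"
  have m: "length m \<le> n"
    using length_for_each[of ?f "\<lambda>_. 1" Bs "[]"] len assms unfolding m_def
    by (simp add: sum_list_triv)
  have "time (check_all (\<lambda>(T, c). do { c' \<leftarrow> count T m; eq_atom c' c }) Ts)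
      \<le> Suc (length Ts * Suc (2 * n + 3))"
  proof (intro time_check_all, clarify)
    fix T c
    show "time (do { c' \<leftarrow> count T m; eq_atom c' c }) \<le> 2 * n + 3"
      using time_count[of T m] m by simp
  qed
  also have "\<dots> \<le> Suc (n * (2 * n + 4))"
    using assms by (intro Suc_le_mono[THEN iffD2] mult_le_mono) auto
  finally show ?thesis
    using t1 by (simp add: verify_cardinality_def m_def)
qed

lemma ports_count_bounds:
  assumes "length k \<le> n"
  shows "time (ports_count gen k) \<le> Suc (n * (2 * n + 3))"
    and "length (val (ports_count gen k)) \<le> n"
proof -
  let ?f = "\<lambda>q m. do { p \<leftarrow> op (gen q); incr p m }"
  have len: "length (val (?f q m)) \<le> length m + 1" for q m
    using length_incr[of "gen q" m] by simp
  have f: "time (?f q m) \<le> 2 * n + 2" if "length m \<le> n" for q m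
    using time_incr[of "gen q" m] that by simp
  have "time (for_each ?f k []) \<le> Suc (length k * Suc (2 * n + 2))"
    by (rule time_for_each[where w = "\<lambda>_. 1" and n = n])
      (use len f assms in \<open>auto simp: sum_list_triv\<close>)
  also have "\<dots> \<le> Suc (n * (2 * n + 3))"
    using assms by (intro Suc_le_mono[THEN iffD2] mult_le_mono) auto
  finally show "time (ports_count gen k) \<le> Suc (n * (2 * n + 3))"
    by (simp add: ports_count_def)
  show "length (val (ports_count gen k)) \<le> n"
    using length_for_each[of ?f "\<lambda>_. 1" k "[]"] len assms unfolding ports_count_def
    by (simp add: sum_list_triv)
qed

lemma time_matches_motif:
  assumes "length pc \<le> n" "length \<Gamma> \<le> n"
  shows "time (matches_motif pc \<Gamma>) \<le> 3 + 3 * (n * (2 * n + 4))"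
proof -
  have mono: "Suc (l * Suc (2 * n + 3)) \<le> Suc (n * (2 * n + 4))" if "l \<le> n" for l
    using that by (intro Suc_le_mono[THEN iffD2] mult_le_mono) auto
  \<comment> \<open>One more than needed, to match the cost of \<open>count\<close> followed by a
    comparison; the three loops then have the same bound.\<close>
  have "time (has_key x pc) \<le> 2 * n + 3" "time (has_key x \<Gamma>) \<le> 2 * n + 3" for x
    using time_has_key[of x pc] time_has_key[of x \<Gamma>] assms by simp_all
  then have "time (check_all (\<lambda>e. has_key (fst e) pc) \<Gamma>) \<le> Suc (n * (2 * n + 4))"
    and "time (check_all (\<lambda>e. has_key (fst e) \<Gamma>) pc) \<le> Suc (n * (2 * n + 4))"
    using mono assms by (meson time_check_all le_trans)+
  moreover have "time (check_all (\<lambda>(p, m, d). do { c \<leftarrow> count p pc; eq_atom c m }) \<Gamma>)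
      \<le> Suc (n * (2 * n + 4))"
  proof (rule le_trans[OF time_check_all mono[OF assms(2)]], clarify)
    fix p m d
    show "time (do { c \<leftarrow> count p pc; eq_atom c m }) \<le> 2 * n + 3"
      using time_count[of p pc] assms by simp
  qed
  ultimately show ?thesis
    by (simp add: matches_motif_def)
qed

lemma time_find_motif:
  "(\<And>\<Gamma>. \<Gamma> \<in> set \<Gamma>s \<Longrightarrow> time (matches_motif pc \<Gamma>) \<le> c) \<Longrightarrow>
     time (find_motif pc \<Gamma>s) \<le> Suc (length \<Gamma>s * Suc c)"
proof (induction \<Gamma>s)
  case (Cons \<Gamma> \<Gamma>s)
  have "time (matches_motif pc \<Gamma>) \<le> c" "time (find_motif pc \<Gamma>s) \<le> Suc (length \<Gamma>s * Suc c)"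
    using Cons by simp_all
  then show ?case by simp
qed simp

lemma time_empty_parts: "time (empty_parts \<Gamma>s) = Suc (length \<Gamma>s)"
  by (induction \<Gamma>s) simp_all

lemma time_add_to_part: "time (add_to_part \<Gamma> k S) \<le> Suc (length S * (2 * length \<Gamma> + 2))"
proof (induction S)
  case (Cons e S)
  then show ?case using time_eq_list[of \<Gamma> "fst e"] by auto
qed simp

lemma keys_add_to_part: "map fst (val (add_to_part \<Gamma> k S)) = map fst S"
  by (induction S) auto

text \<open>The contribution of a list of lists to \<open>input_size\<close>. The extra unit per
  list makes it bound the number of lists as well as their total length, even if some are
  empty.\<close>

abbreviation (input) weight :: "'q list list \<Rightarrow> nat" where
  "weight ks \<equiv> sum_list (map (\<lambda>k. Suc (length k)) ks)"

text \<open>At most one entry receives \<open>k\<close>; if the key is absent, nothing is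
  stored.\<close>

lemma weight_add_to_part:
  "sum_list (map (weight \<circ> snd) (val (add_to_part \<Gamma> k S)))
     \<le> sum_list (map (weight \<circ> snd) S) + Suc (length k)"
  by (induction S) auto

text \<open>Replaces \<open>val_distribute\<close> where motif lists may repeat. It ensures that
  later lookups find their key and that no part outgrows the input.\<close>

lemma distribute_invariants:
  assumes "val (distribute gen \<Gamma>s ks S) = Some S'"
  shows "map fst S' = map fst S"
    and "sum_list (map (weight \<circ> snd) S') \<le> sum_list (map (weight \<circ> snd) S) + weight ks"
proof -
  have "map fst S' = map fst S \<and>
      sum_list (map (weight \<circ> snd) S') \<le> sum_list (map (weight \<circ> snd) S) + weight ks"
    using assms
  proof (induction ks arbitrary: S)
    case (Cons k ks)
    then obtain \<Gamma> where "val (distribute gen \<Gamma>s ks (val (add_to_part \<Gamma> k S))) = Some S'"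
      by (auto split: option.splits)
    from Cons.IH[OF this] weight_add_to_part[of \<Gamma> k S] keys_add_to_part[of \<Gamma> k S]
    show ?case by (simp add: comp_def)
  qed simp
  then show "map fst S' = map fst S"
    and "sum_list (map (weight \<circ> snd) S') \<le> sum_list (map (weight \<circ> snd) S) + weight ks"
    by blast+
qed

lemma time_distribute:
  assumes "length \<Gamma>s \<le> n" "\<And>\<Gamma>. \<Gamma> \<in> set \<Gamma>s \<Longrightarrow> length \<Gamma> \<le> n"
    and "\<And>k. k \<in> set ks \<Longrightarrow> length k \<le> n" "length S \<le> n"
  shows "time (distribute gen \<Gamma>s ks S) \<le>
     Suc (length ks * (4 + n * (2 * n + 3) + n * (4 + 3 * (n * (2 * n + 4))) + n * (2 * n + 2)))"
  using assms(3,4)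
proof (induction ks arbitrary: S)
  case (Cons k ks)
  \<comment> \<open>Cost per connector. The summand 4 collects the loop call and the outer
    \<open>Suc\<close> of the bounds for counting, searching and inserting.\<close>
  define c where
    "c = 4 + n * (2 * n + 3) + n * (4 + 3 * (n * (2 * n + 4))) + n * (2 * n + 2)"
  define pc where "pc = val (ports_count gen k)"
  have k: "length k \<le> n" using Cons.prems by simp
  note pc = ports_count_bounds[OF k, of gen, folded pc_def]
  have "time (find_motif pc \<Gamma>s) \<le> Suc (length \<Gamma>s * Suc (3 + 3 * (n * (2 * n + 4))))"
    by (intro time_find_motif time_matches_motif pc(2) assms(2))
  also have "\<dots> \<le> Suc (n * (4 + 3 * (n * (2 * n + 4))))"
    using assms(1) by (intro Suc_le_mono[THEN iffD2] mult_le_mono) auto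
  finally have find: "time (find_motif pc \<Gamma>s) \<le> Suc (n * (4 + 3 * (n * (2 * n + 4))))" .
  show ?case
  proof (cases "val (find_motif pc \<Gamma>s)")
    case None
    then show ?thesis
      using pc(1) find by (simp add: pc_def[symmetric])
  next
    case (Some \<Gamma>)
    then have "\<Gamma> \<in> set \<Gamma>s"
      by (auto simp: val_find_motif find_Some_iff)
    have "time (add_to_part \<Gamma> k S) \<le> Suc (length S * (2 * length \<Gamma> + 2))"
      by (rule time_add_to_part)
    also have "\<dots> \<le> Suc (n * (2 * n + 2))"
      using Cons.prems assms(2)[OF \<open>\<Gamma> \<in> set \<Gamma>s\<close>]
      by (intro Suc_le_mono[THEN iffD2] mult_le_mono) auto
    finally have add: "time (add_to_part \<Gamma> k S) \<le> Suc (n * (2 * n + 2))" .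
    have "length (val (add_to_part \<Gamma> k S)) = length S"
      using keys_add_to_part[of \<Gamma> k S] by (metis length_map)
    then have "time (distribute gen \<Gamma>s ks (val (add_to_part \<Gamma> k S))) \<le> Suc (length ks * c)"
      unfolding c_def using Cons.prems by (intro Cons.IH) auto
    then have "time (distribute gen \<Gamma>s (k # ks) S) \<le> Suc (length (k # ks) * c)"
      using pc(1) find add Some by (simp add: pc_def[symmetric]) (simp add: c_def)
    then show ?thesis by (simp only: c_def)
  qed
qed simp

lemma length_le_weight: "length ks \<le> weight ks"
  by (induction ks) auto

lemma length_le_weight_member: "k \<in> set ks \<Longrightarrow> length k \<le> weight ks"
  by (induction ks) auto

lemma sum_length_le_weight: "sum_list (map length ks) \<le> weight ks"
  by (induction ks) auto

section \<open>Time of the degree check and of the whole algorithm\<close>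

lemma time_verify_degree:
  assumes "weight ks \<le> n" "length \<Gamma> \<le> n"
  shows "time (verify_degree gen ks \<Gamma>) \<le> 2 + n * (2 + n * (2 * n + 2)) + n * (2 * n + 4)"
proof -
  let ?f = "\<lambda>k m. for_each incr k m"
  have len: "length (val (?f k m)) \<le> length m + length k" for k and m :: "('a \<times> nat) list"
    using length_for_each[of incr "\<lambda>_. 1", OF length_incr[unfolded Suc_eq_plus1], of k m]
    by (simp add: sum_list_triv)
  have f: "time (?f k m) \<le> Suc (n * (2 * n + 2))" if "k \<in> set ks" "length m + length k \<le> n"
    for k and m :: "('a \<times> nat) list"
  proof -
    have "time (for_each incr k m) \<le> Suc (length k * Suc (2 * n + 1))"
    proof (rule time_for_each[where w = "\<lambda>_. 1" and n = n])
      fix x and s :: "('a \<times> nat) list" assume "length s + 1 \<le> n"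
      then show "time (incr x s) \<le> 2 * n + 1" using time_incr[of x s] by simp
    qed (use length_incr that in \<open>auto simp: sum_list_triv\<close>)
    also have "\<dots> \<le> Suc (n * (2 * n + 2))"
      using that by (intro Suc_le_mono[THEN iffD2] mult_le_mono) auto
    finally show ?thesis .
  qed
  have total: "sum_list (map length ks) \<le> n"
    using sum_length_le_weight[of ks] assms(1) by simp
  \<comment> \<open>A connector adds at most as many keys as it has ports, so the growth allowance
    is \<open>length\<close>.\<close>
  have "time (for_each ?f ks []) \<le> Suc (length ks * Suc (Suc (n * (2 * n + 2))))"
    by (rule time_for_each[where w = length and n = n]) (use len f total in auto)
  also have "\<dots> \<le> Suc (n * (2 + n * (2 * n + 2)))"
    using assms(1) length_le_weight[of ks]
    by (intro Suc_le_mono[THEN iffD2] mult_le_mono) auto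
  finally have t1: "time (for_each ?f ks []) \<le> Suc (n * (2 + n * (2 * n + 2)))" .
  define m where "m = val (for_each ?f ks [])"
  have m: "length m \<le> n"
    using length_for_each[of ?f length ks "[]"] len total unfolding m_def by simp
  let ?P = "\<lambda>(q, c). do {
       p \<leftarrow> op (gen q);
       r \<leftarrow> lookup eq_atom p \<Gamma>;
       case r of None \<Rightarrow> ret False | Some md \<Rightarrow> eq_atom c (snd md) }"
  have "time (check_all ?P m) \<le> Suc (length m * Suc (2 * n + 3))"
  proof (intro time_check_all, clarify)
    fix q c
    show "time (do { p \<leftarrow> op (gen q); r \<leftarrow> lookup eq_atom p \<Gamma>;
       case r of None \<Rightarrow> ret False | Some md \<Rightarrow> eq_atom c (snd md) }) \<le> 2 * n + 3"
      using time_lookup_eq_atom[of "gen q" \<Gamma>] assms(2) by (simp split: option.split)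
  qed
  also have "\<dots> \<le> Suc (n * (2 * n + 4))"
    using m by (intro Suc_le_mono[THEN iffD2] mult_le_mono) auto
  finally show ?thesis
    using t1 by (simp add: verify_degree_def m_def)
qed

text \<open>
  The bounds are polymorphic so that they can be instantiated both with a number and with the
  indeterminate of a polynomial.
\<close>

definition cardinality_bound :: "'a::comm_semiring_1 \<Rightarrow> 'a" where
  "cardinality_bound n = 2 + 2 * (n * (2 * n + 4))"

definition multiplicity_bound :: "'a::comm_semiring_1 \<Rightarrow> 'a" where
  "multiplicity_bound n =
     2 + n + n * (4 + n * (2 * n + 3) + n * (4 + 3 * (n * (2 * n + 4))) + n * (2 * n + 2))"

definition degree_bound :: "'a::comm_semiring_1 \<Rightarrow> 'a" where
  "degree_bound n = 2 + n * (2 + n * (2 * n + 2)) + n * (2 * n + 4)"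

definition total_bound :: "'a::comm_semiring_1 \<Rightarrow> 'a" where
  "total_bound n = cardinality_bound n + multiplicity_bound n +
     (1 + n * (2 + n * (2 * n + 2) + degree_bound n))"

text \<open>Evaluation at \<open>n\<close> respects sums and products and sends the indeterminate
  \<open>[:0, 1:]\<close> to \<open>n\<close>.\<close>

lemma poly_total_bound: "poly (total_bound [:0, 1:]) n = total_bound n" for n :: nat
  by (simp add: total_bound_def cardinality_bound_def multiplicity_bound_def degree_bound_def
      algebra_simps)

lemma time_verify_architecture:
  "time (verify_architecture typ gen I) \<le> total_bound (input_size I)"
proof -
  define n where "n = input_size I"
  let ?ks = "in_config I" and ?\<Gamma>s = "in_motifs I"
  have weights: "weight ?ks \<le> n" "weight ?\<Gamma>s \<le> n"
    by (simp_all add: n_def input_size_def)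
  have len: "length (in_components I) \<le> n" "length (in_types I) \<le> n"
    by (simp_all add: n_def input_size_def)
  have lens: "length ?ks \<le> n" "length ?\<Gamma>s \<le> n"
    using length_le_weight weights le_trans by blast+
  have member: "length \<Gamma> \<le> n" if "\<Gamma> \<in> set ?\<Gamma>s" for \<Gamma>
    using length_le_weight_member[OF that] weights by simp
  have member': "length k \<le> n" if "k \<in> set ?ks" for k
    using length_le_weight_member[OF that] weights by simp
  have card: "time (verify_cardinality typ (in_components I) (in_types I)) \<le> cardinality_bound n"
    unfolding cardinality_bound_def by (rule time_verify_cardinality) (fact len)+
  have "time (distribute gen ?\<Gamma>s ?ks (map (\<lambda>\<Gamma>. (\<Gamma>, [])) ?\<Gamma>s)) \<le>
     Suc (length ?ks * (4 + n * (2 * n + 3) + n * (4 + 3 * (n * (2 * n + 4))) + n * (2 * n + 2)))"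
    by (rule time_distribute) (use lens member member' in auto)
  also have "\<dots> \<le>
     Suc (n * (4 + n * (2 * n + 3) + n * (4 + 3 * (n * (2 * n + 4))) + n * (2 * n + 2)))"
    using lens by (intro Suc_le_mono[THEN iffD2] mult_le_mono) auto
  finally have multi: "time (verify_multiplicity gen ?ks ?\<Gamma>s) \<le> multiplicity_bound n"
    using lens
    by (simp add: verify_multiplicity_def time_empty_parts val_empty_parts multiplicity_bound_def)
  have deg: "time (check_all (\<lambda>\<Gamma>. do {
       ks \<leftarrow> lookup eq_list \<Gamma> S; verify_degree gen (the ks) \<Gamma> }) ?\<Gamma>s)
      \<le> 1 + n * (2 + n * (2 * n + 2) + degree_bound n)"
    if S: "val (verify_multiplicity gen ?ks ?\<Gamma>s) = Some S" for S
  proof -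
    have "val (distribute gen ?\<Gamma>s ?ks (map (\<lambda>\<Gamma>. (\<Gamma>, [])) ?\<Gamma>s)) = Some S"
      using S by (simp add: verify_multiplicity_def val_empty_parts)
    note inv = distribute_invariants[OF this]
    have keys: "map fst S = ?\<Gamma>s"
      using inv(1) by (simp add: comp_def)
    have "sum_list (map (weight \<circ> snd) S) \<le> n"
      using inv(2) weights by (simp add: comp_def)
    \<comment> \<open>The weight of one part is a summand of the total weight, which the
      distribution keeps below \<open>n\<close>.\<close>
    then have part: "weight ks \<le> n" if "(\<Gamma>, ks) \<in> set S" for \<Gamma> ks
      using member_le_sum_list[of "weight ks" "map (weight \<circ> snd) S"] that by force
    have "time (check_all (\<lambda>\<Gamma>. do {
         ks \<leftarrow> lookup eq_list \<Gamma> S; verify_degree gen (the ks) \<Gamma> }) ?\<Gamma>s)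
        \<le> Suc (length ?\<Gamma>s * Suc (1 + n * (2 * n + 2) + degree_bound n))"
    proof (rule time_check_all)
      fix \<Gamma> assume \<Gamma>: "\<Gamma> \<in> set ?\<Gamma>s"
      \<comment> \<open>Without this, \<open>the ks\<close> would be an unspecified list and the
        degree check on it would have no bound.\<close>
      then have "map_of S \<Gamma> \<noteq> None"
        using keys by (metis list.set_map map_of_eq_None_iff)
      then obtain ks where ks: "map_of S \<Gamma> = Some ks" by blast
      have "time (lookup eq_list \<Gamma> S) \<le> Suc (length S * Suc (2 * length \<Gamma> + 1))"
        by (rule time_lookup) (rule time_eq_list)
      also have "\<dots> \<le> Suc (n * (2 * n + 2))"
        using lens member[OF \<Gamma>] arg_cong[OF keys, of length]
        by (intro Suc_le_mono[THEN iffD2] mult_le_mono) auto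
      finally have "time (lookup eq_list \<Gamma> S) \<le> Suc (n * (2 * n + 2))" .
      moreover have "time (verify_degree gen ks \<Gamma>) \<le> degree_bound n"
        unfolding degree_bound_def
        by (rule time_verify_degree[OF part[OF map_of_SomeD[OF ks]] member[OF \<Gamma>]])
      ultimately show "time (do { ks \<leftarrow> lookup eq_list \<Gamma> S; verify_degree gen (the ks) \<Gamma> })
          \<le> 1 + n * (2 * n + 2) + degree_bound n"
        by (simp add: ks)
    qed
    also have "\<dots> \<le> Suc (n * (2 + n * (2 * n + 2) + degree_bound n))"
      using lens by (intro Suc_le_mono[THEN iffD2] mult_le_mono) auto
    finally show ?thesis by simp
  qed
  show ?thesis
    using card multi deg
    by (auto simp: verify_architecture_def total_bound_def n_def[symmetric] split: option.split
        intro: add_mono)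
qed


theorem mainTheorem4:
  shows
    "(\<exists>P :: nat poly. \<forall>(typ :: 'b \<Rightarrow> 't) (gen :: 'q \<Rightarrow> 'p) (I :: ('b, 'q, 't, 'p) input).
        time (verify_architecture typ gen I) \<le> poly P (input_size I))
     \<and>
     (\<forall>(A :: ('b, 'q, 't, 'p) architecture) (D :: ('t, 'p) diagram) (I :: ('b, 'q, 't, 'p) input).
        simple_diagram D \<and> architecture_over D A \<and> represents I A D \<longrightarrow>
          (val (verify_cardinality (typeof A) (in_components I) (in_types I))
             \<longleftrightarrow> cardinalities_hold A D)
        \<and> (val (verify_multiplicity (generic A) (in_config I) (in_motifs I)) \<noteq> None
             \<longleftrightarrow> (\<exists>part. motif_partition A D part))
        \<and> (\<forall>S. val (verify_multiplicity (generic A) (in_config I) (in_motifs I)) = Some S \<longrightarrow>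
             motif_partition A D (part_of S) \<and>
             (\<forall>\<Gamma>\<in>set (in_motifs I).
                val (verify_degree (generic A) (the (val (lookup eq_list \<Gamma> S))) \<Gamma>)
                  \<longleftrightarrow> participant_degrees_hold A (map_of \<Gamma>) (part_of S (map_of \<Gamma>))))
        \<and> (val (verify_architecture (typeof A) (generic A) I)
             \<longleftrightarrow> cardinalities_hold A D \<and>
                 (\<exists>part. motif_partition A D part \<and>
                    (\<forall>\<Gamma>\<in>motifs D. participant_degrees_hold A \<Gamma> (part \<Gamma>))))
        \<and> (conforms A D \<longrightarrow>
             val (verify_architecture (typeof A) (generic A) I) \<and> no_idle_instance A D)
        \<and> (no_idle_instance A D \<longrightarrow>
             (val (verify_architecture (typeof A) (generic A) I) \<longleftrightarrow> conforms A D)))"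
proof (rule conjI)
  show "\<exists>P :: nat poly. \<forall>(typ :: 'b \<Rightarrow> 't) (gen :: 'q \<Rightarrow> 'p) (I :: ('b, 'q, 't, 'p) input).
      time (verify_architecture typ gen I) \<le> poly P (input_size I)"
    by (intro exI[of _ "total_bound [:0, 1:]"] allI)
      (simp only: poly_total_bound time_verify_architecture)
next
  show "\<forall>(A :: ('b, 'q, 't, 'p) architecture) (D :: ('t, 'p) diagram) (I :: ('b, 'q, 't, 'p) input).
        simple_diagram D \<and> architecture_over D A \<and> represents I A D \<longrightarrow>
          (val (verify_cardinality (typeof A) (in_components I) (in_types I))
             \<longleftrightarrow> cardinalities_hold A D)
        \<and> (val (verify_multiplicity (generic A) (in_config I) (in_motifs I)) \<noteq> None
             \<longleftrightarrow> (\<exists>part. motif_partition A D part))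
        \<and> (\<forall>S. val (verify_multiplicity (generic A) (in_config I) (in_motifs I)) = Some S \<longrightarrow>
             motif_partition A D (part_of S) \<and>
             (\<forall>\<Gamma>\<in>set (in_motifs I).
                val (verify_degree (generic A) (the (val (lookup eq_list \<Gamma> S))) \<Gamma>)
                  \<longleftrightarrow> participant_degrees_hold A (map_of \<Gamma>) (part_of S (map_of \<Gamma>))))
        \<and> (val (verify_architecture (typeof A) (generic A) I)
             \<longleftrightarrow> cardinalities_hold A D \<and>
                 (\<exists>part. motif_partition A D part \<and>
                    (\<forall>\<Gamma>\<in>motifs D. participant_degrees_hold A \<Gamma> (part \<Gamma>))))
        \<and> (conforms A D \<longrightarrow>
             val (verify_architecture (typeof A) (generic A) I) \<and> no_idle_instance A D)
        \<and> (no_idle_instance A D \<longrightarrow>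
             (val (verify_architecture (typeof A) (generic A) I) \<longleftrightarrow> conforms A D))"
  proof (intro allI impI, elim conjE)
    fix A :: "('b, 'q, 't, 'p) architecture" and D :: "('t, 'p) diagram"
      and I :: "('b, 'q, 't, 'p) input"
    assume "simple_diagram D" "architecture_over D A" "represents I A D"
    then interpret represented_instance A D I by unfold_locales
    have "val (verify_multiplicity (generic A) (in_config I) (in_motifs I)) \<noteq> None
        \<longleftrightarrow> (\<exists>part. motif_partition A D part)"
      \<comment> \<open>Both sides say that every connector fits some motif;
        \<open>forced_part\<close> is then a partition.\<close>
      by (auto simp: verify_multiplicity_eq motif_partition_iff)
    moreover have "motif_partition A D (part_of S) \<and>
        (\<forall>\<Gamma>\<in>set (in_motifs I).
           val (verify_degree (generic A) (the (val (lookup eq_list \<Gamma> S))) \<Gamma>)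
             \<longleftrightarrow> participant_degrees_hold A (map_of \<Gamma>) (part_of S (map_of \<Gamma>)))"
      if "val (verify_multiplicity (generic A) (in_config I) (in_motifs I)) = Some S" for S
      using that
      by (auto simp: verify_multiplicity_eq motif_partition_iff part_of_connectors
          lookup_connectors verify_degree_correct motifs_eq split: if_splits)
    ultimately show "(val (verify_cardinality (typeof A) (in_components I) (in_types I))
             \<longleftrightarrow> cardinalities_hold A D)
        \<and> (val (verify_multiplicity (generic A) (in_config I) (in_motifs I)) \<noteq> None
             \<longleftrightarrow> (\<exists>part. motif_partition A D part))
        \<and> (\<forall>S. val (verify_multiplicity (generic A) (in_config I) (in_motifs I)) = Some S \<longrightarrow>
             motif_partition A D (part_of S) \<and>
             (\<forall>\<Gamma>\<in>set (in_motifs I).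
                val (verify_degree (generic A) (the (val (lookup eq_list \<Gamma> S))) \<Gamma>)
                  \<longleftrightarrow> participant_degrees_hold A (map_of \<Gamma>) (part_of S (map_of \<Gamma>))))
        \<and> (val (verify_architecture (typeof A) (generic A) I)
             \<longleftrightarrow> cardinalities_hold A D \<and>
                 (\<exists>part. motif_partition A D part \<and>
                    (\<forall>\<Gamma>\<in>motifs D. participant_degrees_hold A \<Gamma> (part \<Gamma>))))
        \<and> (conforms A D \<longrightarrow>
             val (verify_architecture (typeof A) (generic A) I) \<and> no_idle_instance A D)
        \<and> (no_idle_instance A D \<longrightarrow>
             (val (verify_architecture (typeof A) (generic A) I) \<longleftrightarrow> conforms A D))"
      using verify_cardinality_correct verify_architecture_correct conforms_iff by blast
  qed
qed

end
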